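(* Let $$A=\begin{pmatrix}1&1\\1&-1\end{pmatrix},\qquad B=\begin{pmatrix}1&-1\\ \tfrac12&\tfrac12\end{pmatrix},\qquad B^{-1}=\begin{pmatrix}\tfrac12&1\\-\tfrac12&1\end{pmatrix}.$$ For every $n\ge1$, the $n$-arity EQUAL gate $|00\cdots0\rangle+|11\cdots1\rangle$ is Pfaffian under the homogeneous change of basis $A\otimes\cdots\otimes A$, and the $n$-arity EQUAL cogate $\langle00\cdots0|+\langle11\cdots1|$ is Pfaffian under the homogeneous change of basis $B^{-1}\otimes\cdots\otimes B^{-1}$; that is, there are $\alpha,\beta\in\mathbb{C}$ and skew-symmetric $\Xi,\Theta\in\mathbb{C}^{n\times n}$ with $A^{\otimes n}(|0\cdots0\rangle+|1\cdots1\rangle)=\alpha\,\mathrm{sPf}(\Xi)$ and $(B^{-1})^{\otimes n}(\langle0\cdots0|+\langle1\cdots1|)=\beta\,\mathrm{sPf}^*(\Theta)$.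
   Context: Let $V=\mathbb{C}^2$ with basis $|0\rangle,|1\rangle$ and dual basis $\langle0|,\langle1|$. An $n$-arity gate is an element of $V^{\otimes n}$, and an $n$-arity cogate is an element of $(V^* )^{\otimes n}$. For $I\subseteq[n]=\{1,\dots,n\}$, $|I\rangle$ and $\langle I|$ denote the basis ket and bra whose bitstring is the indicator of $I$, and $I^C=[n]\setminus I$. Rows and columns of $2\times2$ matrices are indexed by $0,1$. A matrix $M$ acts on kets by $M|j\rangle=M_{0j}|0\rangle+M_{1j}|1\rangle$ and on bras by $M\langle j|=M_{j0}\langle0|+M_{j1}\langle1|$ (row-vector multiplication). For an $n\times n$ complex skew-symmetric matrix $\Xi$ put $\mathrm{sPf}(\Xi)=\sum_{I\subseteq[n]}\mathrm{Pf}(\Xi|_I)|I\rangle$ and $\mathrm{sPf}^*(\Xi)=\sum_{J\subseteq[n]}\mathrm{Pf}(\Xi|_{J^C})\langle J|$, where $\Xi|_I$ is the submatrix with rows and columns in $I$, and the Pfaffian $\mathrm{Pf}$ is $1$ for the empty matrix and $0$ for odd size. *)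

theory Defs
  imports "Jordan_Normal_Form.Determinant" "Jordan_Normal_Form.DL_Submatrix"
begin

text \<open>The index set \<open>[n]\<close> is \<open>{0..<n}\<close>. A tensor is given by its coordinates with respect
  to the basis kets (for gates) or basis bras (for cogates), which are labelled by the
  subsets of \<open>[n]\<close>; the coordinate function vanishes on all other sets, so that equality of
  tensors is equality of functions.\<close>

type_synonym gate = "nat set \<Rightarrow> complex"
type_synonym cogate = "nat set \<Rightarrow> complex"

definition ket :: "nat set \<Rightarrow> gate" where
  "ket I = (\<lambda>K. if K = I then 1 else 0)"

definition bra :: "nat set \<Rightarrow> cogate" where
  "bra J = (\<lambda>K. if K = J then 1 else 0)"

definition bit_at :: "nat set \<Rightarrow> nat \<Rightarrow> nat" where
  "bit_at I i = (if i \<in> I then 1 else 0)"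

text \<open>Coordinates of \<open>v 0 \<otimes> \<dots> \<otimes> v (n - 1)\<close>, where each \<open>v i\<close> has dimension 2.\<close>

definition tensor :: "nat \<Rightarrow> (nat \<Rightarrow> complex vec) \<Rightarrow> nat set \<Rightarrow> complex" where
  "tensor n v = (\<lambda>I. if I \<subseteq> {0..<n} then (\<Prod>i = 0..<n. v i $ bit_at I i) else 0)"

lemma tensor_unit_vec_eq_ket:
  assumes "J \<subseteq> {0..<n}"
  shows "tensor n (\<lambda>i. unit_vec 2 (bit_at J i)) = ket J"
proof
  fix I
  show "tensor n (\<lambda>i. unit_vec 2 (bit_at J i)) I = ket J I"
  proof (cases "I \<subseteq> {0..<n} \<and> I \<noteq> J")
    case True
    then have "\<exists>i\<in>{0..<n}. (i \<in> I) \<noteq> (i \<in> J)"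
      using assms by blast
    then obtain i where i: "i \<in> {0..<n}" "(i \<in> I) \<noteq> (i \<in> J)"
      by blast
    have "unit_vec 2 (bit_at J i) $ bit_at I i = (0::complex)"
      using i(2) by (cases "i \<in> I"; simp add: bit_at_def)
    then have "(\<Prod>i = 0..<n. unit_vec 2 (bit_at J i) $ bit_at I i) = (0::complex)"
      using i(1) by (intro prod_zero) blast+
    then show ?thesis
      using True by (simp add: tensor_def ket_def)
  next
    case False
    have "unit_vec 2 (bit_at J i) $ bit_at J i = (1::complex)" for i
      by (simp add: bit_at_def)
    then show ?thesis
      using assms False by (cases "I = J") (simp_all add: tensor_def ket_def)
  qed
qed

text \<open>\<open>M 0 \<otimes> \<dots> \<otimes> M (n - 1)\<close> acts factorwise on basis tensors, extended linearly; a matrix acts on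
  kets as columns and on bras as rows, the latter by right multiplication, i.e. through its
  transpose.\<close>

definition act_gate :: "nat \<Rightarrow> (nat \<Rightarrow> complex mat) \<Rightarrow> gate \<Rightarrow> gate" where
  "act_gate n M g =
     (\<lambda>K. \<Sum>I\<in>Pow {0..<n}. g I * tensor n (\<lambda>i. M i *\<^sub>v unit_vec 2 (bit_at I i)) K)"

definition act_cogate :: "nat \<Rightarrow> (nat \<Rightarrow> complex mat) \<Rightarrow> cogate \<Rightarrow> cogate" where
  "act_cogate n M h =
     (\<lambda>K. \<Sum>J\<in>Pow {0..<n}. h J * tensor n (\<lambda>i. (M i)\<^sup>T *\<^sub>v unit_vec 2 (bit_at J i)) K)"

definition skew_symmetric_mat :: "complex mat \<Rightarrow> bool" where
  "skew_symmetric_mat X \<longleftrightarrow> X\<^sup>T = - X"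

definition pfaffian :: "complex mat \<Rightarrow> complex" where
  "pfaffian X =
     (if odd (dim_row X) then 0
      else let m = dim_row X div 2 in
        (\<Sum>\<sigma> | \<sigma> permutes {0..<2 * m}.
           of_int (sign \<sigma>) * (\<Prod>i = 0..<m. X $$ (\<sigma> (2 * i), \<sigma> (2 * i + 1))))
        / (2 ^ m * fact m))"

definition sPf :: "nat \<Rightarrow> complex mat \<Rightarrow> gate" where
  "sPf n X = (\<lambda>K. \<Sum>I\<in>Pow {0..<n}. pfaffian (submatrix X I I) * ket I K)"

definition sPf_dual :: "nat \<Rightarrow> complex mat \<Rightarrow> cogate" where
  "sPf_dual n X =
     (\<lambda>K. \<Sum>J\<in>Pow {0..<n}. pfaffian (submatrix X ({0..<n} - J) ({0..<n} - J)) * bra J K)"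

definition equal_gate :: "nat \<Rightarrow> gate" where
  "equal_gate n = (\<lambda>K. ket {} K + ket {0..<n} K)"

definition equal_cogate :: "nat \<Rightarrow> cogate" where
  "equal_cogate n = (\<lambda>K. bra {} K + bra {0..<n} K)"

definition pfaffian_gate_under :: "nat \<Rightarrow> (nat \<Rightarrow> complex mat) \<Rightarrow> gate \<Rightarrow> bool" where
  "pfaffian_gate_under n M g \<longleftrightarrow>
     (\<exists>\<alpha>. \<exists>\<Xi>\<in>carrier_mat n n. skew_symmetric_mat \<Xi> \<and>
        act_gate n M g = (\<lambda>K. \<alpha> * sPf n \<Xi> K))"

definition pfaffian_cogate_under :: "nat \<Rightarrow> (nat \<Rightarrow> complex mat) \<Rightarrow> cogate \<Rightarrow> bool" where
  "pfaffian_cogate_under n M h \<longleftrightarrow>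
     (\<exists>\<beta>. \<exists>\<Theta>\<in>carrier_mat n n. skew_symmetric_mat \<Theta> \<and>
        act_cogate n M h = (\<lambda>K. \<beta> * sPf_dual n \<Theta> K))"

end

theory Submission imports Defs begin

text \<open>Both transformed EQUAL tensors have coordinates that depend only on the number of set bits.
  The columns of \<open>A\<close> are \<open>(1, 1)\<close> and \<open>(1, -1)\<close>, so the coordinate of the gate at \<open>K\<close> is
  \<open>1 + (-1) ^ |K|\<close>: it is \<open>2\<close> when \<open>|K|\<close> is even and \<open>0\<close> otherwise. The rows of \<open>B'\<close> are
  \<open>(1/2, 1)\<close> and \<open>(-1/2, 1)\<close>, so with \<open>k = n - |K|\<close> the coordinate of the cogate at \<open>K\<close> is
  \<open>(1/2) ^ k + (-1/2) ^ k\<close>: it is \<open>2 * (1/4) ^ (k div 2)\<close> when \<open>k\<close> is even and \<open>0\<close> otherwise.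

  These are exactly twice the sub-Pfaffians of the skew-symmetric matrix whose entries above the
  diagonal all equal \<open>c\<close>, with \<open>c = 1\<close> and \<open>c = 1/4\<close> respectively. Every principal submatrix of
  such a matrix is again of the same form, so only one Pfaffian for each size \<open>2 * m\<close> is needed,
  and it is \<open>c ^ m\<close> (\<open>pfaffian_upper_constant_skew_mat\<close>).

  The evaluation of that Pfaffian rests on \<open>signed_order_sum\<close>. Fixing the values \<open>b\<close> and \<open>a\<close> that
  a permutation takes in its last two positions and relabelling the remaining values in
  increasing order leaves all other comparisons unchanged, so the sum for \<open>m + 1\<close> is a
  numerical factor times the sum for \<open>m\<close>. For each of the \<open>2 * m + 2\<close> choices of \<open>b\<close> the signed
  sum over \<open>a\<close> collapses to \<open>1\<close>, so the factor is \<open>2 * (m + 1)\<close>, and the normalisation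
  \<open>2 ^ m * m!\<close> of the Pfaffian cancels exactly.\<close>

section \<open>Signed sums over permutations\<close>

text \<open>This is a Laplace expansion with an arbitrary weight in place of a product of matrix entries.
  The permutations of \<open>n + 1\<close> points that send the last point to \<open>j\<close> arise from those of \<open>n\<close>
  points by inserting the value \<open>j\<close>, and moving \<open>j\<close> past the \<open>n - j\<close> larger values gives the sign
  \<open>(-1) ^ (n + j)\<close>.\<close>

lemma sum_permutes_last_value:
  fixes f :: "(nat \<Rightarrow> nat) \<Rightarrow> 'a::comm_ring_1"
  shows "(\<Sum>\<sigma> | \<sigma> permutes {0..<Suc n}. of_int (sign \<sigma>) * f \<sigma>) =
    (\<Sum>j<Suc n. (-1) ^ (n + j) *
      (\<Sum>\<tau> | \<tau> permutes {0..<n}. of_int (sign \<tau>) * f (permutation_insert n j \<tau>)))"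
proof -
  let ?P = "{\<sigma>. \<sigma> permutes {0..<Suc n}}"
  let ?g = "\<lambda>\<sigma>. of_int (sign \<sigma>) * f \<sigma>"
  have fin: "finite ?P"
    by (simp add: finite_permutations)
  have last: "(\<lambda>\<sigma>. \<sigma> n) ` ?P \<subseteq> {..<Suc n}"
    by (auto dest!: permutes_in_image[of _ _ n])
  have "sum ?g ?P = (\<Sum>j<Suc n. sum ?g {\<sigma> \<in> ?P. \<sigma> n = j})"
    using sum.group[OF fin _ last, of ?g] by simp
  also have "\<dots> = (\<Sum>j<Suc n. (-1) ^ (n + j) *
      (\<Sum>\<tau> | \<tau> permutes {0..<n}. of_int (sign \<tau>) * f (permutation_insert n j \<tau>)))"
  proof (rule sum.cong[OF refl])
    fix j assume "j \<in> {..<Suc n}"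
    then have j: "j < Suc n"
      by simp
    have fiber: "{\<sigma> \<in> ?P. \<sigma> n = j} = permutation_insert n j ` {\<tau>. \<tau> permutes {0..<n}}"
      using permutation_fix[OF lessI j] by auto
    have "sum ?g {\<sigma> \<in> ?P. \<sigma> n = j} =
        (\<Sum>\<tau> | \<tau> permutes {0..<n}. ?g (permutation_insert n j \<tau>))"
      unfolding fiber
      by (subst sum.reindex[OF permutation_insert_inj_on[OF lessI j]]) simp
    also have "\<dots> = (-1) ^ (n + j) *
        (\<Sum>\<tau> | \<tau> permutes {0..<n}. of_int (sign \<tau>) * f (permutation_insert n j \<tau>))"
      unfolding sum_distrib_left
      by (intro sum.cong) (auto simp: signof_permutation_insert[OF _ lessI j] mult.assoc)
    finally show "sum ?g {\<sigma> \<in> ?P. \<sigma> n = j} = (-1) ^ (n + j) *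
        (\<Sum>\<tau> | \<tau> permutes {0..<n}. of_int (sign \<tau>) * f (permutation_insert n j \<tau>))" .
  qed
  finally show ?thesis .
qed

section \<open>The Pfaffian of a matrix that is constant above the diagonal\<close>

definition order_sign :: "nat \<Rightarrow> nat \<Rightarrow> 'a::comm_ring_1" where
  "order_sign a b = (if a < b then 1 else if b < a then -1 else 0)"

lemma order_sign_strict_mono:
  assumes "strict_mono_on S f" "a \<in> S" "b \<in> S"
  shows "order_sign (f a) (f b) = order_sign a b"
  using strict_mono_onD[OF assms(1)] assms(2,3)
  by (metis less_asym linorder_cases order_sign_def)

lemma order_sign_insert_index:
  "order_sign (insert_index j a) (insert_index j b) = order_sign a b"
  by (auto simp: order_sign_def insert_index_def)

text \<open>Here \<open>a\<close> is a value before relabelling. It is shifted upwards exactly when \<open>a \<ge> b\<close>, which is why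
  the boundary case \<open>a = b\<close> counts as lying above \<open>b\<close>.\<close>

lemma order_sign_insert_index_inserted:
  "order_sign (insert_index b a) b = (if a < b then 1 else -1)"
  by (auto simp: order_sign_def insert_index_def)

lemma permutation_insert_last_below:
  "i < n \<Longrightarrow> permutation_insert n j \<tau> i = insert_index j (\<tau> i)"
  by (simp add: permutation_insert_expand insert_index_def)

text \<open>With \<open>b = 0\<close> this is minus an alternating sum of odd length. Raising \<open>b\<close> by one flips only the sign of the term
  \<open>(-1) ^ b\<close>, hence adds \<open>2 * (-1) ^ b\<close>, which turns \<open>- ((-1) ^ b)\<close> into its negative.\<close>

lemma alternating_sum_odd_split:
  "b \<le> 2 * m + 1 \<Longrightarrow>
    (\<Sum>a<2 * m + 1. (-1) ^ a * (if a < b then 1 else -1)) = - ((-1) ^ b :: 'a::comm_ring_1)"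
proof (induction b)
  case 0
  have "(\<Sum>a<2 * m + 1. (-1) ^ a) = (1::'a)"
    by (induction m) auto
  then show ?case
    by (simp add: sum_negf)
next
  case (Suc b)
  have "(\<Sum>a<2 * m + 1. (-1) ^ a * (if a < Suc b then 1 else -1)) =
      (\<Sum>a<2 * m + 1. (-1) ^ a * (if a < b then 1 else -1) + (if a = b then 2 * (-1) ^ b else (0::'a)))"
    by (intro sum.cong) (auto simp: less_Suc_eq)
  also have "\<dots> = - ((-1) ^ b) + 2 * (-1) ^ b"
    using Suc by (simp only: sum.distrib) simp
  finally show ?case
    by simp
qed

text \<open>The value says that the \<open>2 * m\<close> by \<open>2 * m\<close> matrix with all entries above the diagonal equal to
  \<open>1\<close> has Pfaffian \<open>1\<close>. The induction removes the last block \<open>(2 * m, 2 * m + 1)\<close> of positions by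
  two expansions, first along the value \<open>b\<close> at the last position and then along the value \<open>a\<close> at the
  one before it.\<close>

lemma signed_order_sum:
  "(\<Sum>\<sigma> | \<sigma> permutes {0..<2 * m}.
      of_int (sign \<sigma>) * (\<Prod>i = 0..<m. order_sign (\<sigma> (2 * i)) (\<sigma> (2 * i + 1)))) =
    (2 ^ m * fact m :: 'a::{comm_ring_1, semiring_char_0})"
proof (induction m)
  case 0
  have "{\<sigma>. \<sigma> permutes ({}::nat set)} = {id}"
    by auto
  then show ?case
    by simp
next
  case (Suc m)
  define block :: "nat \<Rightarrow> (nat \<Rightarrow> nat) \<Rightarrow> 'a" where
    "block k \<sigma> = (\<Prod>i = 0..<k. order_sign (\<sigma> (2 * i)) (\<sigma> (2 * i + 1)))" for k \<sigma>
  have block_insert: "block m (permutation_insert n j \<tau>) = block m \<tau>" if "2 * m \<le> n" for n j \<tau>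
    unfolding block_def
    by (rule prod.cong)
      (use that in \<open>auto simp: permutation_insert_last_below order_sign_insert_index\<close>)
  \<comment> \<open>The last block compares \<open>a\<close>, after it has been shifted to make room for \<open>b\<close>, with \<open>b\<close>.\<close>
  have split: "block (Suc m) (permutation_insert (Suc (2 * m)) b (permutation_insert (2 * m) a \<rho>)) =
      (if a < b then 1 else -1) * block m \<rho>" for a b \<rho>
  proof -
    let ?\<tau> = "permutation_insert (2 * m) a \<rho>"
    let ?\<sigma> = "permutation_insert (Suc (2 * m)) b ?\<tau>"
    have "block (Suc m) ?\<sigma> = block m ?\<sigma> * order_sign (?\<sigma> (2 * m)) (?\<sigma> (2 * m + 1))"
      by (simp add: block_def)
    also have "order_sign (?\<sigma> (2 * m)) (?\<sigma> (2 * m + 1)) = (if a < b then 1 else - (1::'a))"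
      by (simp add: permutation_insert_last_below order_sign_insert_index_inserted)
    finally show ?thesis
      by (simp add: block_insert)
  qed
  let ?S = "\<Sum>\<rho> | \<rho> permutes {0..<2 * m}. of_int (sign \<rho>) * block m \<rho>"
  have "(\<Sum>\<sigma> | \<sigma> permutes {0..<2 * Suc m}. of_int (sign \<sigma>) * block (Suc m) \<sigma>) =
     (\<Sum>b<Suc (Suc (2 * m)). (-1) ^ (Suc (2 * m) + b) *
      (\<Sum>a<Suc (2 * m). (-1) ^ (2 * m + a) * ((if a < b then 1 else -1) * ?S)))"
    unfolding mult_Suc_right add_2_eq_Suc sum_permutes_last_value split
    by (simp only: mult.left_commute sum_distrib_left)
  also have "\<dots> = (\<Sum>b<Suc (Suc (2 * m)). (-1) ^ (Suc (2 * m) + b) *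
      (\<Sum>a<2 * m + 1. (-1) ^ a * (if a < b then 1 else -1))) * ?S"
    by (simp add: sum_distrib_right power_add mult.assoc del: sum.lessThan_Suc)
  also have "(\<Sum>b<Suc (Suc (2 * m)). (-1) ^ (Suc (2 * m) + b) *
      (\<Sum>a<2 * m + 1. (-1) ^ a * (if a < b then 1 else -1))) =
      (\<Sum>b<Suc (Suc (2 * m)). (1::'a))"
  \<comment> \<open>The sign of inserting \<open>b\<close> is \<open>- ((-1) ^ b)\<close>, the same as the inner sum, so each product is \<open>1\<close>.\<close>
  proof (rule sum.cong[OF refl])
    fix b assume "b \<in> {..<Suc (Suc (2 * m))}"
    then have "b \<le> 2 * m + 1"
      by simp
    show "(-1) ^ (Suc (2 * m) + b) *
        (\<Sum>a<2 * m + 1. (-1) ^ a * (if a < b then 1 else -1)) = (1::'a)"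
      unfolding alternating_sum_odd_split[OF \<open>b \<le> 2 * m + 1\<close>]
      by (simp add: power_add flip: power_mult_distrib)
  qed
  also have "\<dots> * ?S = 2 ^ Suc m * fact (Suc m)"
    using Suc.IH unfolding block_def by (simp add: algebra_simps)
  finally show ?case
    unfolding block_def .
qed

definition upper_constant_skew_mat :: "nat \<Rightarrow> complex \<Rightarrow> complex mat" where
  "upper_constant_skew_mat n c = mat n n (\<lambda>(i, j). c * order_sign i j)"

lemma upper_constant_skew_mat_carrier: "upper_constant_skew_mat n c \<in> carrier_mat n n"
  by (simp add: upper_constant_skew_mat_def)

lemma skew_symmetric_upper_constant_skew_mat:
  "skew_symmetric_mat (upper_constant_skew_mat n c)"
  unfolding skew_symmetric_mat_def upper_constant_skew_mat_def
  by (rule eq_matI) (auto simp: order_sign_def)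

text \<open>An entry depends only on the order of its two indices, and the enumeration of \<open>I\<close> by \<open>pick\<close> is
  increasing.\<close>

lemma submatrix_upper_constant_skew_mat:
  assumes "I \<subseteq> {0..<n}"
  shows "submatrix (upper_constant_skew_mat n c) I I = upper_constant_skew_mat (card I) c"
proof -
  have rows: "{i. i < n \<and> i \<in> I} = I"
    using assms by auto
  have below: "pick I k < n" if "k < card I" for k
    using pick_in_set_le[OF that] assms by auto
  have "strict_mono_on {..<card I} (pick I)"
    by (auto intro!: strict_mono_onI pick_mono_le)
  from order_sign_strict_mono[OF this]
  show ?thesis
    by (intro eq_matI)
      (auto simp: dim_submatrix submatrix_index upper_constant_skew_mat_def rows below)
qed

lemma pfaffian_upper_constant_skew_mat:
  "pfaffian (upper_constant_skew_mat k c) = (if odd k then 0 else c ^ (k div 2))"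
proof (cases "odd k")
  case True
  then show ?thesis
    by (simp add: pfaffian_def upper_constant_skew_mat_def)
next
  case False
  then obtain m where k: "k = 2 * m"
    by blast
  have entries: "(\<Prod>i = 0..<m. upper_constant_skew_mat (2 * m) c $$ (\<sigma> (2 * i), \<sigma> (2 * i + 1))) =
      c ^ m * (\<Prod>i = 0..<m. order_sign (\<sigma> (2 * i)) (\<sigma> (2 * i + 1)))"
    if "\<sigma> permutes {0..<2 * m}" for \<sigma>
  proof -
    have "\<sigma> i < 2 * m" if "i < 2 * m" for i
      using permutes_in_image[OF \<open>\<sigma> permutes {0..<2 * m}\<close>, of i] that by simp
    then have "(\<Prod>i = 0..<m. upper_constant_skew_mat (2 * m) c $$ (\<sigma> (2 * i), \<sigma> (2 * i + 1))) =
        (\<Prod>i = 0..<m. c * order_sign (\<sigma> (2 * i)) (\<sigma> (2 * i + 1)))"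
      by (intro prod.cong) (auto simp: upper_constant_skew_mat_def)
    then show ?thesis
      by (simp add: prod.distrib)
  qed
  have "(\<Sum>\<sigma> | \<sigma> permutes {0..<2 * m}. of_int (sign \<sigma>) *
      (\<Prod>i = 0..<m. upper_constant_skew_mat (2 * m) c $$ (\<sigma> (2 * i), \<sigma> (2 * i + 1)))) =
      c ^ m * (\<Sum>\<sigma> | \<sigma> permutes {0..<2 * m}. of_int (sign \<sigma>) *
        (\<Prod>i = 0..<m. order_sign (\<sigma> (2 * i)) (\<sigma> (2 * i + 1))))"
    unfolding sum_distrib_left
    by (rule sum.cong) (auto simp: entries mult.left_commute simp del: One_nat_def)
  also have "\<dots> = c ^ m * (2 ^ m * fact m)"
    by (simp only: signed_order_sum)
  finally show ?thesis
    unfolding pfaffian_def Let_def k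
    by (simp add: upper_constant_skew_mat_def)
qed

section \<open>Coordinates of the two sides\<close>

lemma sPf_coordinate:
  "sPf n X K = (if K \<subseteq> {0..<n} then pfaffian (submatrix X K K) else 0)"
  by (simp add: sPf_def ket_def sum.delta if_distrib cong: if_cong)

lemma sPf_dual_coordinate:
  "sPf_dual n X K =
    (if K \<subseteq> {0..<n} then pfaffian (submatrix X ({0..<n} - K) ({0..<n} - K)) else 0)"
  by (simp add: sPf_dual_def bra_def sum.delta if_distrib cong: if_cong)

text \<open>The two indicators are added rather than joined by a disjunction, so for \<open>n = 0\<close>, where both ends
  coincide, the empty set is counted twice, as it is in the definition of the EQUAL tensors.\<close>

lemma sum_Pow_ends:
  fixes f :: "nat set \<Rightarrow> complex"
  shows "(\<Sum>I\<in>Pow {0..<n}. ((if I = {} then 1 else 0) + (if I = {0..<n} then 1 else 0)) * f I) =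
    f {} + f {0..<n}"
  by (simp add: distrib_right sum.distrib if_distrib[of "\<lambda>x. x * _"] sum.delta cong: if_cong)

text \<open>A tensor power of a single vector only sees how many bits of \<open>K\<close> are set.\<close>

lemma tensor_constant:
  assumes "K \<subseteq> {0..<n}"
  shows "tensor n (\<lambda>_. v) K = v $ 1 ^ card K * v $ 0 ^ card ({0..<n} - K)"
proof -
  have "tensor n (\<lambda>_. v) K = (\<Prod>i\<in>{0..<n}. if i \<in> K then v $ 1 else v $ 0)"
    using assms by (auto simp: tensor_def bit_at_def intro!: prod.cong)
  also have "\<dots> = v $ 1 ^ card K * v $ 0 ^ card ({0..<n} - K)"
    using assms by (simp add: prod.If_cases Int_absorb1 Diff_eq)
  finally show ?thesis .
qed

lemma tensor_bits_cong:
  assumes "\<And>i. i < n \<Longrightarrow> v i = w i"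
  shows "tensor n v = tensor n w"
  using assms by (auto simp: tensor_def fun_eq_iff)

text \<open>By linearity a change of basis sends the EQUAL tensor to the sum of the tensor powers of the
  images of the two basis vectors: the columns of \<open>M\<close> for the gate, its rows for the cogate.\<close>

lemma act_gate_equal_gate:
  "act_gate n (\<lambda>_. M) (equal_gate n) K =
    tensor n (\<lambda>_. M *\<^sub>v unit_vec 2 0) K + tensor n (\<lambda>_. M *\<^sub>v unit_vec 2 1) K"
proof -
  have "tensor n (\<lambda>i. M *\<^sub>v unit_vec 2 (bit_at {0..<n} i)) = tensor n (\<lambda>_. M *\<^sub>v unit_vec 2 1)"
    by (rule tensor_bits_cong) (simp add: bit_at_def)
  then show ?thesis
    unfolding act_gate_def equal_gate_def ket_def sum_Pow_ends by (simp add: bit_at_def)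
qed

lemma act_cogate_equal_cogate:
  "act_cogate n (\<lambda>_. M) (equal_cogate n) K =
    tensor n (\<lambda>_. M\<^sup>T *\<^sub>v unit_vec 2 0) K + tensor n (\<lambda>_. M\<^sup>T *\<^sub>v unit_vec 2 1) K"
proof -
  have "tensor n (\<lambda>i. M\<^sup>T *\<^sub>v unit_vec 2 (bit_at {0..<n} i)) = tensor n (\<lambda>_. M\<^sup>T *\<^sub>v unit_vec 2 1)"
    by (rule tensor_bits_cong) (simp add: bit_at_def)
  then show ?thesis
    unfolding act_cogate_def equal_cogate_def bra_def sum_Pow_ends by (simp add: bit_at_def)
qed

lemma equal_gate_pfaffian:
  "pfaffian_gate_under n (\<lambda>_. mat_of_rows_list 2 [[1, 1], [1, -1]]) (equal_gate n)"
proof -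
  let ?A = "mat_of_rows_list 2 [[1, 1], [1, -1]] :: complex mat"
  have cols: "(?A *\<^sub>v unit_vec 2 0) $ 0 = 1" "(?A *\<^sub>v unit_vec 2 0) $ 1 = 1"
    "(?A *\<^sub>v unit_vec 2 1) $ 0 = 1" "(?A *\<^sub>v unit_vec 2 1) $ 1 = -1"
    by (simp_all add: mat_of_rows_list_def)
  have "act_gate n (\<lambda>_. ?A) (equal_gate n) K = 2 * sPf n (upper_constant_skew_mat n 1) K" for K
  proof (cases "K \<subseteq> {0..<n}")
    case True
    then show ?thesis
      by (simp add: act_gate_equal_gate tensor_constant cols[simplified] sPf_coordinate
          submatrix_upper_constant_skew_mat pfaffian_upper_constant_skew_mat)
  next
    case False
    then show ?thesis
      by (simp add: act_gate_equal_gate tensor_def sPf_coordinate)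
  qed
  then show ?thesis
    unfolding pfaffian_gate_under_def
    using upper_constant_skew_mat_carrier skew_symmetric_upper_constant_skew_mat by blast
qed

lemma equal_cogate_pfaffian:
  "pfaffian_cogate_under n (\<lambda>_. mat_of_rows_list 2 [[1 / 2, 1], [- 1 / 2, 1]]) (equal_cogate n)"
proof -
  let ?B = "mat_of_rows_list 2 [[1 / 2, 1], [- 1 / 2, 1]] :: complex mat"
  have rows: "(?B\<^sup>T *\<^sub>v unit_vec 2 0) $ 0 = 1 / 2" "(?B\<^sup>T *\<^sub>v unit_vec 2 0) $ 1 = 1"
    "(?B\<^sup>T *\<^sub>v unit_vec 2 1) $ 0 = - 1 / 2" "(?B\<^sup>T *\<^sub>v unit_vec 2 1) $ 1 = 1"
    by (simp_all add: mat_of_rows_list_def)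
  \<comment> \<open>The source of the entry \<open>1 / 4\<close>: a matched pair of unset bits contributes \<open>(1 / 2)\<^sup>2\<close>.\<close>
  have halves: "(1 / 2) ^ k + (- 1 / 2) ^ k = 2 * (if odd k then 0 else (1 / 4) ^ (k div 2) :: complex)"
    for k :: nat
  proof (cases "odd k")
    case True
    then show ?thesis by (simp add: power_minus_odd)
  next
    case False
    then obtain m where "k = 2 * m" by blast
    then show ?thesis by (simp add: power_mult power2_eq_square)
  qed
  have "act_cogate n (\<lambda>_. ?B) (equal_cogate n) K =
      2 * sPf_dual n (upper_constant_skew_mat n (1 / 4)) K" for K
  proof (cases "K \<subseteq> {0..<n}")
    case True
    then show ?thesis
      unfolding act_cogate_equal_cogate tensor_constant[OF True] rows sPf_dual_coordinate
        submatrix_upper_constant_skew_mat[OF Diff_subset] pfaffian_upper_constant_skew_mat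
      using halves by simp
  next
    case False
    then show ?thesis
      by (simp add: act_cogate_equal_cogate tensor_def sPf_dual_coordinate)
  qed
  then show ?thesis
    unfolding pfaffian_cogate_under_def
    using upper_constant_skew_mat_carrier skew_symmetric_upper_constant_skew_mat by blast
qed

theorem proposition1:
  fixes n :: nat and A B B' :: "complex mat"
  assumes "A = mat_of_rows_list 2 [[1, 1], [1, -1]]"
    and "B = mat_of_rows_list 2 [[1, -1], [1 / 2, 1 / 2]]"
    and "B' = mat_of_rows_list 2 [[1 / 2, 1], [- 1 / 2, 1]]"
    and "n \<ge> 1"
  shows "inverts_mat B B' \<and> inverts_mat B' B
    \<and> pfaffian_gate_under n (\<lambda>_. A) (equal_gate n)
    \<and> pfaffian_cogate_under n (\<lambda>_. B') (equal_cogate n)"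
proof (intro conjI)
  show "inverts_mat B B'"
    unfolding inverts_mat_def assms
    by (rule eq_matI) (auto simp: mat_of_rows_list_def scalar_prod_def numeral_2_eq_2 less_Suc_eq)
  show "inverts_mat B' B"
    unfolding inverts_mat_def assms
    by (rule eq_matI) (auto simp: mat_of_rows_list_def scalar_prod_def numeral_2_eq_2 less_Suc_eq)
  show "pfaffian_gate_under n (\<lambda>_. A) (equal_gate n)"
    unfolding assms by (rule equal_gate_pfaffian)
  show "pfaffian_cogate_under n (\<lambda>_. B') (equal_cogate n)"
    unfolding assms by (rule equal_cogate_pfaffian)
qed

end
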